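(* Let $H$ be a connected, non-trivial graph. Then for all integers $k \ge 2$, $$r(H^{k}) \le rc(H^{k}) \le 2\,r(H^{k}) + 1.$$
   Context: All graphs are finite, simple and undirected. A graph is trivial if it has order (number of vertices) 0 or 1, and non-trivial otherwise. For a connected graph $G$: $dist_G(u,v)$ is the length (number of edges) of a shortest path between $u$ and $v$; the eccentricity of a vertex $v$ is $ecc(v)=\max\{dist_G(v,u): u\in V(G)\}$; the radius is $r(G)=\min\{ecc(v): v\in V(G)\}$. An edge coloring of $G$ is any function from $E(G)$ to a set of colors (not necessarily proper). A path is a rainbow path if no two of its edges have the same color. An edge coloring is a rainbow coloring if every pair of vertices is connected by at least one rainbow path. The rainbow connection number $rc(G)$ of a connected graph $G$ is the minimum number of colors in a rainbow coloring of $G$. The $k$-th power $G^{k}$ ($k\ge 1$) of a graph $G$ has vertex set $V(G)$, and two distinct vertices $u,v$ are adjacent in $G^{k}$ if and only if $dist_G(u,v)\le k$. *)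

theory Defs
  imports "Graph_Theory.Pair_Digraph" "Graph_Theory.Digraph_Component"
begin

text \<open>
  Finite simple undirected graphs are the symmetric loop-free finite digraphs of locale
  \<open>pair_graph\<close>: the undirected edge \<open>{u, v}\<close> is the pair of arcs \<open>(u, v)\<close>, \<open>(v, u)\<close>.
  Paths are the \<open>apath\<close>s, arc lists whose vertices are pairwise distinct; the empty list is the
  path of length 0 from a vertex to itself.

  The minima and maxima below are meant for connected, non-empty graphs only, where they are
  attained (see the lemmas at the end).
\<close>

definition gdist :: "'a pair_pre_digraph \<Rightarrow> 'a \<Rightarrow> 'a \<Rightarrow> nat" where
  "gdist G u v = (LEAST n. \<exists>p. pre_digraph.apath (with_proj G) u p v \<and> length p = n)"

definition ecc :: "'a pair_pre_digraph \<Rightarrow> 'a \<Rightarrow> nat" where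
  "ecc G v = Max {gdist G v u | u. u \<in> pverts G}"

definition radius :: "'a pair_pre_digraph \<Rightarrow> nat" where
  "radius G = Min {ecc G v | v. v \<in> pverts G}"

definition graph_power :: "'a pair_pre_digraph \<Rightarrow> nat \<Rightarrow> 'a pair_pre_digraph" where
  "graph_power G k =
    \<lparr> pverts = pverts G,
      parcs = {(u, v). u \<in> pverts G \<and> v \<in> pverts G \<and> u \<noteq> v \<and> gdist G u v \<le> k} \<rparr>"

definition uedges :: "'a pair_pre_digraph \<Rightarrow> 'a set set" where
  "uedges G = {{u, v} | u v. (u, v) \<in> parcs G}"

text \<open>
  A colouring assigns a colour to each undirected edge, so both arcs of an edge automatically
  receive the same colour; its values outside \<open>uedges G\<close> are irrelevant. As graphs are finite,
  natural numbers suffice as colours.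
\<close>

definition rainbow_path ::
  "'a pair_pre_digraph \<Rightarrow> ('a set \<Rightarrow> nat) \<Rightarrow> 'a \<Rightarrow> ('a \<times> 'a) list \<Rightarrow> 'a \<Rightarrow> bool" where
  "rainbow_path G c u p v \<longleftrightarrow>
    pre_digraph.apath (with_proj G) u p v \<and> distinct (map (\<lambda>(x, y). c {x, y}) p)"

definition rainbow_coloring :: "'a pair_pre_digraph \<Rightarrow> ('a set \<Rightarrow> nat) \<Rightarrow> bool" where
  "rainbow_coloring G c \<longleftrightarrow>
    (\<forall>u \<in> pverts G. \<forall>v \<in> pverts G. \<exists>p. rainbow_path G c u p v)"

definition rc :: "'a pair_pre_digraph \<Rightarrow> nat" where
  "rc G = (LEAST n. \<exists>c. rainbow_coloring G c \<and> card (c ` uedges G) = n)"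

lemma connected_apath:
  assumes "pair_graph G" "Digraph_Component.connected (with_proj G)"
    and "u \<in> pverts G" "v \<in> pverts G"
  obtains p where "pre_digraph.apath (with_proj G) u p v"
proof -
  interpret pair_graph G by fact
  have "u \<rightarrow>\<^sup>*\<^bsub>with_proj (mk_symmetric (with_proj G))\<^esub> v"
    using assms by (simp add: Digraph_Component.connected_def strongly_connected_def mk_symmetric_def)
  then have "u \<rightarrow>\<^sup>*\<^bsub>with_proj G\<^esub> v"
    using reachable_mk_symmetric_eq[OF pair_sym_arcs] by simp
  then show thesis using that reachable_apath[of u v] by blast
qed

lemma gdist_attained:
  assumes "pair_graph G" "Digraph_Component.connected (with_proj G)"
    and "u \<in> pverts G" "v \<in> pverts G"
  shows "\<exists>p. pre_digraph.apath (with_proj G) u p v \<and> length p = gdist G u v"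
proof -
  obtain p where "pre_digraph.apath (with_proj G) u p v"
    using connected_apath[OF assms] .
  then have "\<exists>n p. pre_digraph.apath (with_proj G) u p v \<and> length p = n" by blast
  from LeastI_ex[OF this] show ?thesis unfolding gdist_def .
qed

lemma gdist_commute:
  assumes "pair_graph G"
  shows "gdist G u v = gdist G v u"
proof -
  interpret pair_graph G by fact
  have len: "length (rev_path p) = length p" for p :: "('a \<times> 'a) list"
    by (induction p) auto
  have "(\<exists>p. pre_digraph.apath (with_proj G) u p v \<and> length p = n) \<longleftrightarrow>
      (\<exists>p. pre_digraph.apath (with_proj G) v p u \<and> length p = n)" for n
    by (metis apath_rev_path len)
  then show ?thesis unfolding gdist_def by simp
qed

lemma pair_graph_graph_power:
  assumes "pair_graph G"
  shows "pair_graph (graph_power G k)"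
proof -
  interpret pair_graph G by fact
  have "finite (parcs (graph_power G k))"
    by (rule finite_subset[of _ "pverts G \<times> pverts G"]) (auto simp: graph_power_def)
  then show ?thesis
    using gdist_commute[OF assms]
    by unfold_locales (auto simp: graph_power_def symmetric_def sym_def)
qed

lemma connected_graph_power:
  assumes G: "pair_graph G" and conn: "Digraph_Component.connected (with_proj G)" and "1 \<le> k"
  shows "Digraph_Component.connected (with_proj (graph_power G k))"
proof -
  interpret pair_graph G by fact
  have le1: "gdist G u v \<le> 1" if "(u, v) \<in> parcs G" for u v
  proof -
    have "apath u [(u, v)] v"
      using that no_loops' by (auto simp: apath_def awalk_def dest: in_arcsD1)
    then show ?thesis unfolding gdist_def by (intro Least_le) force
  qed
  have "parcs (mk_symmetric (with_proj G)) \<subseteq> parcs (mk_symmetric (with_proj (graph_power G k)))"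
    using le1 \<open>1 \<le> k\<close>
    by (fastforce simp: parcs_mk_symmetric graph_power_def dest: in_arcsD1 in_arcsD2 no_loops')
  moreover have "pverts (mk_symmetric (with_proj G)) \<subseteq>
      pverts (mk_symmetric (with_proj (graph_power G k)))"
    by (simp add: mk_symmetric_def graph_power_def)
  ultimately have "u \<rightarrow>\<^sup>*\<^bsub>with_proj (mk_symmetric (with_proj (graph_power G k)))\<^esub> v"
    if "u \<rightarrow>\<^sup>*\<^bsub>with_proj (mk_symmetric (with_proj G))\<^esub> v" for u v
    using that unfolding reachable_def with_proj_simps by (rule rtrancl_on_mono)
  with conn show ?thesis
    unfolding Digraph_Component.connected_def strongly_connected_def
    by (simp add: mk_symmetric_def graph_power_def)
qed

lemma rc_attained:
  assumes "pair_graph G" "Digraph_Component.connected (with_proj G)"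
  shows "\<exists>c. rainbow_coloring G c \<and> card (c ` uedges G) = rc G"
proof -
  interpret pair_graph G by fact
  have "uedges G = (\<lambda>(u, v). {u, v}) ` parcs G" by (auto simp: uedges_def)
  then have "finite (uedges G)" by simp
  then obtain c :: "'a set \<Rightarrow> nat" where c: "inj_on c (uedges G)"
    using finite_imp_inj_to_nat_seg by blast
  have arcs: "distinct (map (\<lambda>(x, y). {x, y}) p)" if "pre_digraph.apath (with_proj G) u p v" for u p v
    using that
  proof (induction p arbitrary: u)
    case (Cons e p)
    obtain x y where e: "e = (x, y)" by fastforce
    have p: "apath y p v" and x: "x \<notin> set (awalk_verts y p)" and w: "awalk y p v"
      using Cons.prems e by (auto simp: apath_Cons_iff apath_def awalk_Cons_iff)
    have "fst a \<in> set (awalk_verts y p) \<and> snd a \<in> set (awalk_verts y p)" if "a \<in> set p" for a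
      using awalk_verts_arc1[OF that, of y] awalk_verts_arc2[OF w that] by simp
    then show ?case using Cons.IH[OF p] x e by (force simp: doubleton_eq_iff)
  qed simp
  have "rainbow_coloring G c"
    unfolding rainbow_coloring_def
  proof (intro ballI)
    fix u v assume "u \<in> pverts G" "v \<in> pverts G"
    then obtain p where p: "apath u p v" using connected_apath[OF assms] by blast
    then have "set (map (\<lambda>(x, y). {x, y}) p) \<subseteq> uedges G"
      by (auto simp: apath_def awalk_def uedges_def)
    with c have "inj_on c (set (map (\<lambda>(x, y). {x, y}) p))" by (rule inj_on_subset)
    with arcs[OF p] have "distinct (map c (map (\<lambda>(x, y). {x, y}) p))"
      by (simp only: distinct_map)
    then show "\<exists>p. rainbow_path G c u p v"
      using p by (auto simp: rainbow_path_def comp_def case_prod_unfold)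
  qed
  then have "\<exists>n c. rainbow_coloring G c \<and> card (c ` uedges G) = n" by blast
  from LeastI_ex[OF this] show ?thesis unfolding rc_def .
qed

end

theory Submission
  imports Defs "HOL-Library.Sublist"
begin

text \<open>
  For the upper bound let \<open>u\<close> be a central vertex of \<open>H\<^sup>k\<close>, call the distance in \<open>H\<close> from \<open>u\<close> to
  \<open>x\<close> the level of \<open>x\<close>, and let layer \<open>i\<close> consist of the levels in \<open>(k (i - 1), k i]\<close>, so that there
  are at most \<open>r = r(H\<^sup>k)\<close> layers besides \<open>u\<close>. If all levels are at most \<open>1\<close>, then \<open>H\<^sup>k\<close> is
  complete; otherwise edges inside a layer get colour \<open>0\<close>. Edges
  between layers \<open>i - 1\<close> and \<open>i\<close> get one of two colours, \<open>2 i - 1\<close> and \<open>2 i\<close>: for \<open>i \<ge> 2\<close> the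
  choice depends on whether the end in layer \<open>i - 1\<close> is on level \<open>k (i - 1)\<close>, for \<open>i = 1\<close> on a two-colouring
  of the first layer, essentially the parity of the level. Descending a geodesic through the levels
  \<open>k j\<close>, or through the levels \<open>k j - 1\<close>, gives rainbow walks to \<open>u\<close> with disjoint sets of colours.
  Every vertex starts a walk of one of the two kinds, and a walk of the other kind after at
  most one step of colour \<open>0\<close>. Hence two walks to \<open>u\<close> from any two vertices can be chosen with
  disjoint sets of colours.
\<close>

subsection \<open>Walks and distances\<close>

text \<open>Cutting out closed detours only deletes arcs, so distinctness of colours passes from the
  walk to the path.\<close>

lemma (in pair_graph) subseq_apath:
  assumes "awalk u p v"
  shows "\<exists>q. apath u q v \<and> subseq q p"
  using assms
proof (induction p arbitrary: u)
  case Nil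
  then show ?case by (intro exI[of _ "[]"]) (auto simp: awalk_Nil_iff apath_Nil_iff)
next
  case (Cons e p)
  then obtain q where q: "apath (snd e) q v" "subseq q p" and e: "e \<in> parcs G" "u = fst e"
    by (auto simp: awalk_Cons_iff)
  show ?case
  proof (cases "u \<in> set (awalk_verts (snd e) q)")
    case True
    have "awalk (snd e) q v" using q by (auto simp: apath_def)
    from awalk_decomp[OF this True] obtain a b where
      ab: "q = a @ b" "awalk (snd e) a u" "awalk u b v" by blast
    have "awlast (snd e) a = u" using ab(2) by auto
    then have "apath u b v" using q(1) ab(1) by (simp add: apath_append_iff)
    moreover have "subseq b q" using ab(1) by (simp add: list_emb_append2)
    then have "subseq b (e # p)" using q(2) by (blast intro: subseq_order.trans)
    ultimately show ?thesis by blast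
  next
    case False
    then have "apath u (e # q) v" using q e by (auto simp: apath_Cons_iff)
    then show ?thesis using q(2) by (intro exI[of _ "e # q"]) simp
  qed
qed

lemma gdist_le_apath: "pre_digraph.apath (with_proj G) u p v \<Longrightarrow> gdist G u v \<le> length p"
  unfolding gdist_def by (rule Least_le) blast

lemma (in pair_graph) gdist_le_awalk: "awalk u p v \<Longrightarrow> gdist G u v \<le> length p"
  by (meson gdist_le_apath list_emb_length order.trans subseq_apath)

lemma (in pair_graph) gdist_self: "u \<in> pverts G \<Longrightarrow> gdist G u u = 0"
  using gdist_le_awalk[of u "[]" u] by (simp add: awalk_Nil_iff)

lemma (in pair_graph) gdist_arc:
  assumes "(u, v) \<in> parcs G"
  shows "gdist G u v \<le> 1"
proof -
  have "awalk u [(u, v)] v"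
    using assms in_arcsD2 by (auto simp: awalk_Cons_iff awalk_Nil_iff)
  from gdist_le_awalk[OF this] show ?thesis by simp
qed

lemma pverts_graph_power: "pverts (graph_power G k) = pverts G"
  by (simp add: graph_power_def)

section \<open>Distances in a connected graph and in its powers\<close>

locale conn_pair_graph = pair_graph H for H :: "'a pair_pre_digraph" +
  assumes conn: "Digraph_Component.connected (with_proj H)"
begin

lemma geodesic:
  assumes "x \<in> pverts H" "y \<in> pverts H"
  obtains p where "awalk x p y" "length p = gdist H x y"
  using gdist_attained[OF pair_graph_axioms conn assms] by (auto simp: apath_def)

lemma gdist_triangle:
  assumes "x \<in> pverts H" "y \<in> pverts H" "z \<in> pverts H"
  shows "gdist H x z \<le> gdist H x y + gdist H y z"
proof -
  obtain p where p: "awalk x p y" "length p = gdist H x y" using geodesic assms by blast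
  obtain q where q: "awalk y q z" "length q = gdist H y z" using geodesic assms by blast
  show ?thesis using gdist_le_awalk[OF awalk_appendI[OF p(1) q(1)]] p q by simp
qed

lemma gdist_eq_0:
  assumes "x \<in> pverts H" "y \<in> pverts H"
  shows "gdist H x y = 0 \<longleftrightarrow> x = y"
proof
  assume "gdist H x y = 0"
  moreover obtain p where "awalk x p y" "length p = gdist H x y" using geodesic assms by blast
  ultimately show "x = y" by (simp add: awalk_Nil_iff)
qed (use assms gdist_self in simp)

text \<open>Cut a geodesic after \<open>l\<close> arcs; the triangle inequality turns the bounds on
  the pieces into equalities. The successor \<open>w\<close> later shows that a stop on level 1 is
  no twig.\<close>

lemma geodesic_step:
  assumes "x \<in> pverts H" "y \<in> pverts H" "l < gdist H x y"
  obtains v w where "(v, w) \<in> parcs H" "gdist H x v = l" "gdist H x w = Suc l"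
    "gdist H v y = gdist H x y - l"
proof -
  obtain p where p: "awalk x p y" "length p = gdist H x y" using geodesic assms by blast
  have "l < length p" using p(2) assms(3) by simp
  then obtain v w a b where split: "p = a @ (v, w) # b" "length a = l"
    using id_take_nth_drop[of l p] by (metis length_take min.absorb4 surj_pair)
  have 1: "awalk x a (awlast x a)" and 3: "awalk (awlast x a) ((v, w) # b) y"
    using p(1) by (simp_all add: split(1))
  then have arc: "(v, w) \<in> parcs H" and v: "awlast x a = v" and 2: "awalk w b y"
    by (simp_all add: awalk_Cons_iff)
  note 1 = 1[unfolded v] and 3 = 3[unfolded v]
  have verts: "v \<in> pverts H" "w \<in> pverts H" using arc by (auto dest: in_arcsD1 in_arcsD2)
  have "gdist H x v \<le> l" "gdist H v y \<le> gdist H x y - l" "gdist H w y \<le> gdist H x y - Suc l"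
    using gdist_le_awalk[OF 1] gdist_le_awalk[OF 2] gdist_le_awalk[OF 3] p(2) assms(3) split by auto
  moreover have "gdist H v w \<le> 1" using gdist_arc[OF arc] .
  moreover note gdist_triangle[OF assms(1) verts(1) assms(2)]
    gdist_triangle[OF assms(1) verts(2) assms(2)] gdist_triangle[OF assms(1) verts(1) verts(2)]
  ultimately show thesis using assms(3) arc by (intro that[of v w]) auto
qed

lemma gdist_le_power_awalk:
  assumes "pre_digraph.awalk (with_proj (graph_power H k)) x p y"
  shows "gdist H x y \<le> k * length p"
proof -
  interpret P: pair_graph "graph_power H k" by (rule pair_graph_graph_power) unfold_locales
  show ?thesis using assms
  proof (induction p arbitrary: x)
    case Nil
    then have "x = y" "x \<in> pverts (graph_power H k)" using P.awalk_Nil_iff by blast+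
    then show ?case by (simp add: gdist_self pverts_graph_power)
  next
    case (Cons e p)
    then have e: "e \<in> parcs (graph_power H k)" "x = fst e" and w: "P.awalk (snd e) p y"
      by (auto simp: P.awalk_Cons_iff)
    have "gdist H (fst e) (snd e) \<le> k" "fst e \<in> pverts H" "snd e \<in> pverts H"
      using e by (auto simp: graph_power_def)
    moreover have "y \<in> pverts H" using P.awalk_last_in_verts[OF w] by (simp add: pverts_graph_power)
    ultimately show ?case using Cons.IH[OF w] gdist_triangle[of x "snd e" y] e by simp
  qed
qed

end

section \<open>Radius, eccentricity and the lower bound\<close>

lemma radius_le_ecc:
  assumes "finite (pverts G)" "v \<in> pverts G"
  shows "radius G \<le> ecc G v"
  unfolding radius_def using assms by (intro Min_le) (auto simp: setcompr_eq_image)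

lemma radius_attained:
  assumes "finite (pverts G)" "pverts G \<noteq> {}"
  obtains v where "v \<in> pverts G" "ecc G v = radius G"
proof -
  have "Min {ecc G v | v. v \<in> pverts G} \<in> {ecc G v | v. v \<in> pverts G}"
    using assms by (intro Min_in) (auto simp: setcompr_eq_image)
  then show thesis using that unfolding radius_def by auto
qed

lemma gdist_le_ecc:
  assumes "finite (pverts G)" "v \<in> pverts G"
  shows "gdist G u v \<le> ecc G u"
  unfolding ecc_def using assms by (intro Max_ge) (auto simp: setcompr_eq_image)

lemma ecc_le:
  assumes "finite (pverts G)" "pverts G \<noteq> {}" "\<And>v. v \<in> pverts G \<Longrightarrow> gdist G u v \<le> n"
  shows "ecc G u \<le> n"
  unfolding ecc_def using assms by (subst Max_le_iff) (auto simp: setcompr_eq_image)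

lemma (in pair_graph) finite_uedges: "finite (uedges G)"
proof -
  have "uedges G = (\<lambda>(u, v). {u, v}) ` parcs G" by (auto simp: uedges_def)
  then show ?thesis by simp
qed

text \<open>A rainbow path is no longer than the number of colours, so even an arbitrary vertex has
  eccentricity at most \<open>rc G\<close>.\<close>

lemma radius_le_rc:
  assumes "pair_graph G" "Digraph_Component.connected (with_proj G)" "pverts G \<noteq> {}"
  shows "radius G \<le> rc G"
proof -
  interpret pair_graph G by fact
  obtain c where c: "rainbow_coloring G c" "card (c ` uedges G) = rc G"
    using rc_attained[OF assms(1,2)] by blast
  obtain u where u: "u \<in> pverts G" using assms(3) by blast
  have "gdist G u v \<le> rc G" if v: "v \<in> pverts G" for v
  proof -
    obtain p where "rainbow_path G c u p v"
      using c(1) u v unfolding rainbow_coloring_def by blast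
    then have p: "apath u p v" "distinct (map (\<lambda>(x, y). c {x, y}) p)"
      by (simp_all add: rainbow_path_def)
    have "set (map (\<lambda>(x, y). c {x, y}) p) \<subseteq> c ` uedges G"
      using p(1) by (auto simp: apath_def awalk_def uedges_def)
    from card_mono[OF finite_imageI[OF finite_uedges] this]
    have "card (set (map (\<lambda>(x, y). c {x, y}) p)) \<le> rc G" using c(2) by simp
    then show ?thesis using gdist_le_apath[OF p(1)] distinct_card[OF p(2)] by simp
  qed
  then show ?thesis
    using ecc_le[of G u "rc G"] radius_le_ecc[of G u] u assms(3) pair_finite_verts by force
qed

section \<open>Reductions for the upper bound\<close>

lemma rc_le:
  assumes "pair_graph G" "rainbow_coloring G c" "c ` uedges G \<subseteq> C" "finite C"
  shows "rc G \<le> card C"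
proof -
  have "rc G \<le> card (c ` uedges G)" unfolding rc_def using assms(2) by (intro Least_le) blast
  also have "\<dots> \<le> card C" using assms(3,4) by (intro card_mono)
  finally show ?thesis .
qed

lemma rainbow_coloringI:
  assumes "pair_graph G"
    and "\<And>u v. u \<in> pverts G \<Longrightarrow> v \<in> pverts G \<Longrightarrow>
      \<exists>p. pre_digraph.awalk (with_proj G) u p v \<and> distinct (map (\<lambda>(x, y). c {x, y}) p)"
  shows "rainbow_coloring G c"
  unfolding rainbow_coloring_def
proof (intro ballI)
  interpret pair_graph G by fact
  fix u v assume "u \<in> pverts G" "v \<in> pverts G"
  then obtain p where p: "awalk u p v" "distinct (map (\<lambda>(x, y). c {x, y}) p)"
    using assms(2) by blast
  obtain q where q: "apath u q v" "subseq q p" using subseq_apath[OF p(1)] by blast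
  have "distinct (map (\<lambda>(x, y). c {x, y}) q)"
    using subseq_map[OF q(2)] p(2) by (metis subseq_conv_nths distinct_nthsI)
  then show "\<exists>p. rainbow_path G c u p v" using q(1) unfolding rainbow_path_def by blast
qed

subsection \<open>The coloring\<close>

locale rooted_graph_power = conn_pair_graph H for H :: "'a pair_pre_digraph" +
  fixes k :: nat and u :: 'a
  assumes k_ge_2: "2 \<le> k" and root: "u \<in> pverts H"
begin

sublocale P: pair_graph "graph_power H k"
  by (rule pair_graph_graph_power) unfold_locales

abbreviation lev :: "'a \<Rightarrow> nat" where "lev x \<equiv> gdist H u x"

definition layer :: "'a \<Rightarrow> nat" where "layer x = (lev x + k - 1) div k"

definition twig :: "'a \<Rightarrow> bool" where
  "twig x \<longleftrightarrow> lev x = 1 \<and> (\<forall>y. (x, y) \<in> parcs H \<longrightarrow> lev y \<noteq> 2)"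

text \<open>
  The shift by \<open>k\<close> puts level \<open>k\<close> on the side \<open>True\<close>. A twig has no neighbour on level 2, so it is
  switched to the side opposite to the level-1 vertices that have one.
\<close>

definition side :: "'a \<Rightarrow> bool" where "side x \<longleftrightarrow> even (lev x + k) \<noteq> twig x"

text \<open>An edge is an unordered set, so its ends are told apart by their layers. For
  \<open>i = 1\<close> the inner end is always the root and cannot decide the colour; hence the
  outer end does.\<close>

definition coloring :: "'a set \<Rightarrow> nat" where
  "coloring e = (let i = Max (layer ` e) in
     if Min (layer ` e) = i then 0
     else if i = 1 then 1 + of_bool (\<exists>x\<in>e. layer x = 1 \<and> side x)
     else 2 * i - 1 + of_bool (\<exists>y\<in>e. layer y < i \<and> k dvd lev y))"

abbreviation colors :: "('a \<times> 'a) list \<Rightarrow> nat list" where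
  "colors p \<equiv> map (\<lambda>(x, y). coloring {x, y}) p"

text \<open>One colour for each passage between consecutive layers on the way to the root: odd if
  \<open>s\<close> is false, even and positive if \<open>s\<close> is true.\<close>

definition palette :: "bool \<Rightarrow> nat \<Rightarrow> nat set" where
  "palette s i = (\<lambda>j. 2 * j + 1 + of_bool s) ` {..<i}"

section \<open>Arithmetic of layers, colours and palettes\<close>

lemma layer_le_iff: "layer x \<le> i \<longleftrightarrow> lev x \<le> k * i"
proof -
  have "layer x \<le> i \<longleftrightarrow> (lev x + k - 1) div k < Suc i" by (auto simp: layer_def)
  also have "\<dots> \<longleftrightarrow> lev x + k - 1 < Suc i * k"
    using k_ge_2 by (intro div_less_iff_less_mult) simp
  also have "\<dots> \<longleftrightarrow> lev x \<le> k * i" using k_ge_2 by (auto simp: algebra_simps)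
  finally show ?thesis .
qed

lemma layer_eq_Suc_iff: "layer x = Suc i \<longleftrightarrow> k * i < lev x \<and> lev x \<le> k * Suc i"
  using layer_le_iff[of x i] layer_le_iff[of x "Suc i"] by auto

lemma layer_eq_0_iff: "x \<in> pverts H \<Longrightarrow> layer x = 0 \<longleftrightarrow> x = u"
  using layer_le_iff[of x 0] gdist_eq_0[OF root] by auto

lemma layer_root: "layer u = 0"
  using layer_eq_0_iff root by simp

lemma coloring_same: "layer x = layer y \<Longrightarrow> coloring {x, y} = 0"
  by (simp add: coloring_def)

lemma coloring_root: "layer x = 1 \<Longrightarrow> layer y = 0 \<Longrightarrow> coloring {x, y} = 1 + of_bool (side x)"
  by (simp add: coloring_def)

lemma coloring_Suc:
  "layer x = Suc i \<Longrightarrow> layer y = i \<Longrightarrow> 1 \<le> i \<Longrightarrow>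
    coloring {x, y} = 2 * i + 1 + of_bool (k dvd lev y)"
  by (auto simp: coloring_def max_def min_def)

lemma coloring_le:
  assumes "layer x \<le> r" "layer y \<le> r"
  shows "coloring {x, y} \<le> 2 * r"
proof -
  define i where "i = Max (layer ` {x, y})"
  have "i \<le> r" using assms by (auto simp: i_def)
  moreover have "Min (layer ` {x, y}) \<noteq> i \<Longrightarrow> 1 \<le> i" by (auto simp: i_def max_def min_def split: if_splits)
  ultimately show ?thesis unfolding coloring_def i_def[symmetric] Let_def by auto
qed

lemma power_arcI:
  "x \<in> pverts H \<Longrightarrow> y \<in> pverts H \<Longrightarrow> x \<noteq> y \<Longrightarrow> gdist H x y \<le> k \<Longrightarrow> (x, y) \<in> parcs (graph_power H k)"
  by (simp add: graph_power_def)

lemma palette_Suc: "palette s (Suc i) = insert (2 * i + 1 + of_bool s) (palette s i)"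
  by (simp add: palette_def lessThan_Suc)

lemma fresh_palette: "2 * i + 1 + of_bool s \<notin> palette s i"
  by (auto simp: palette_def)

lemma palette_disjoint: "palette s i \<inter> insert 0 (palette (\<not> s) j) = {}"
  by (cases s) (auto simp: palette_def, presburger+)

section \<open>Rainbow walks to the root\<close>

text \<open>Each descent to the next layer spends one new palette colour. The last hypothesis
  secures the first step: without \<open>s\<close>, the top level of a layer is \<open>k + 1\<close>
  above the next stop; in layer 1 the root edge must have the palette's colour.\<close>

lemma direct_walk:
  assumes "x \<in> pverts H" "layer x = Suc i"
    and "if i = 0 then side x = s else s \<or> \<not> k dvd lev x"
  shows "\<exists>p. P.awalk x p u \<and> distinct (colors p) \<and> set (colors p) \<subseteq> palette s (layer x)"
  using assms
proof (induction i arbitrary: x)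
  case 0
  have "lev x \<le> k" "x \<noteq> u" using 0 layer_eq_Suc_iff[of x 0] layer_root by auto
  then have "(x, u) \<in> parcs (graph_power H k)"
    using power_arcI 0(1) root gdist_commute[OF pair_graph_axioms, of x u] by simp
  then have "P.awalk x [(x, u)] u"
    using root by (simp add: P.awalk_Cons_iff P.awalk_Nil_iff pverts_graph_power)
  moreover have "coloring {x, u} = 1 + of_bool s" using coloring_root layer_root 0 by simp
  ultimately show ?case using 0(2) by (intro exI[of _ "[(x, u)]"]) (simp add: palette_def)
next
  case (Suc i)
  \<comment> \<open>The level of the next stop; \<open>2 \<le> k\<close> keeps it in layer
    \<open>Suc i\<close> also when 1 is subtracted.\<close>
  define d where "d = k * Suc i - of_bool (\<not> s)"
  have lx: "k * Suc i < lev x" "lev x \<le> k * Suc (Suc i)" using Suc.prems layer_eq_Suc_iff by auto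
  have "d < lev x" using lx by (simp add: d_def)
  then obtain y z where yz: "(y, z) \<in> parcs H" "lev y = d" "lev z = Suc d" "gdist H y x = lev x - d"
    using geodesic_step[OF root Suc.prems(1)] by metis
  have y: "y \<in> pverts H" using yz(1) by (auto dest: in_arcsD1)
  have "lev x - d \<le> k"
  proof (cases s)
    case False
    then have "lev x \<noteq> k * Suc (Suc i)" using Suc.prems(3) by (auto simp del: mult_Suc_right)
    then show ?thesis using lx False by (auto simp: d_def)
  qed (use lx d_def in auto)
  then have dist: "gdist H x y \<le> k" using yz(4) gdist_commute[OF pair_graph_axioms, of x y] by simp
  have dvd: "k dvd d \<longleftrightarrow> s"
  proof (cases s)
    case False
    have "k * i < d" "d < k * Suc i" using k_ge_2 False by (auto simp: d_def)
    then show ?thesis using False by (metis dvd_def mult_less_cancel1 less_Suc_eq_le not_le)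
  qed (simp add: d_def)
  have ly: "layer y = Suc i" unfolding layer_eq_Suc_iff yz(2) using k_ge_2 by (cases s) (auto simp: d_def)
  have "if i = 0 then side y = s else s \<or> \<not> k dvd lev y"
  proof (cases "i = 0")
    case True
    \<comment> \<open>If \<open>y\<close> is on level 1 (so \<open>k = 2\<close> and
      \<open>s\<close> is false), its neighbour \<open>z\<close> is on level 2. Thus the side of
      \<open>y\<close> is the plain parity of \<open>d + k\<close>, with \<open>d\<close> equal to
      \<open>k\<close> or \<open>k - 1\<close>.\<close>
    have "\<not> twig y" using yz by (auto simp: twig_def)
    then have "side y \<longleftrightarrow> even (d + k)" by (simp add: side_def yz(2))
    also have "\<dots> \<longleftrightarrow> s" using k_ge_2 True by (cases s) (auto simp: d_def)
    finally show ?thesis using True by simp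
  qed (use dvd yz(2) in simp)
  then obtain p where p: "P.awalk y p u" "distinct (colors p)" "set (colors p) \<subseteq> palette s (Suc i)"
    using Suc.IH[OF y ly] ly by auto
  have "x \<noteq> y" using ly Suc.prems(2) by auto
  then have "(x, y) \<in> parcs (graph_power H k)" using power_arcI Suc.prems(1) y dist by simp
  then have "P.awalk x ((x, y) # p) u" using p(1) by (simp add: P.awalk_Cons_iff)
  moreover have "coloring {x, y} = 2 * Suc i + 1 + of_bool s"
    using coloring_Suc[OF Suc.prems(2) ly] dvd yz(2) by simp
  ultimately show ?case
    using p(2,3) fresh_palette[of "Suc i" s] Suc.prems(2)
    by (intro exI[of _ "(x, y) # p"]) (auto simp: palette_Suc)
qed

text \<open>One move inside layer 1 flips the side: one level down from level 2 or more, up to level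
  2 from a non-twig on level 1, or from a twig to a non-twig on level 1, whose existence
  \<open>nonstar\<close> provides.\<close>

lemma opposite_neighbour:
  assumes nonstar: "\<exists>z\<in>pverts H. 2 \<le> lev z" and x: "x \<in> pverts H" "layer x = 1"
  obtains y where "(x, y) \<in> parcs (graph_power H k)" "layer y = 1" "side y \<noteq> side x"
proof -
  have lx: "0 < lev x" "lev x \<le> k" using x layer_eq_Suc_iff[of x 0] by auto
  have "\<exists>y. y \<in> pverts H \<and> gdist H x y \<le> k \<and> 0 < lev y \<and> lev y \<le> k \<and> side y \<noteq> side x"
  proof (cases "lev x = 1")
    case False
    then have "lev x - 1 < lev x" using lx by simp
    from geodesic_step[OF root x(1) this] obtain y z where yz: "(y, z) \<in> parcs H"
      "lev y = lev x - 1" "lev z = Suc (lev x - 1)" "gdist H y x = lev x - (lev x - 1)" by blast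
    have "\<not> twig y" "\<not> twig x" using yz lx False by (auto simp: twig_def)
    then have "side y \<noteq> side x" using lx yz(2) by (simp add: side_def)
    moreover have "gdist H x y \<le> k"
      using yz(4) lx k_ge_2 gdist_commute[OF pair_graph_axioms, of x y] by simp
    ultimately show ?thesis using yz lx False by (intro exI[of _ y]) (auto dest: in_arcsD1)
  next
    case lev1: True
    show ?thesis
    proof (cases "twig x")
      case False
      then obtain y where y: "(x, y) \<in> parcs H" "lev y = 2" using lev1 by (auto simp: twig_def)
      then have "side y \<noteq> side x" using lev1 False by (simp add: side_def twig_def)
      then show ?thesis using y k_ge_2 gdist_arc[OF y(1)] by (intro exI[of _ y]) (auto dest: in_arcsD2)
    next
      case True
      \<comment> \<open>A geodesic from the root to \<open>w\<close> meets level 1 in a non-twig. It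
        has the same parity as \<open>x\<close>, so the twig switch alone separates the sides; via
        the root its distance from \<open>x\<close> is at most 2.\<close>
      obtain w where "w \<in> pverts H" "1 < lev w" using nonstar by fastforce
      from geodesic_step[OF root this] obtain y z where
        yz: "(y, z) \<in> parcs H" "lev y = 1" "lev z = Suc 1" by metis
      have y: "y \<in> pverts H" using yz(1) by (auto dest: in_arcsD1)
      have "\<not> twig y" using yz by (auto simp: twig_def)
      then have "side y \<noteq> side x" using True lev1 yz(2) by (simp add: side_def)
      moreover have "gdist H x y \<le> 2"
        using gdist_triangle[OF x(1) root y] lev1 yz(2) gdist_commute[OF pair_graph_axioms, of x u]
        by simp
      ultimately show ?thesis using y yz(2) k_ge_2 by (intro exI[of _ y]) auto
    qed
  qed
  then obtain y where y: "y \<in> pverts H" "gdist H x y \<le> k" "0 < lev y" "lev y \<le> k" "side y \<noteq> side x"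
    by blast
  moreover have "x \<noteq> y" using y by auto
  ultimately show thesis using that[of y] power_arcI x(1) layer_eq_Suc_iff[of y 0] by simp
qed

text \<open>In layer 1 the side of \<open>x\<close> dictates \<open>s\<close>; farther out
  \<open>True\<close> is always admissible.\<close>

lemma some_direct_walk:
  assumes "x \<in> pverts H"
  shows "\<exists>s p. P.awalk x p u \<and> distinct (colors p) \<and> set (colors p) \<subseteq> palette s (layer x)"
proof (cases "layer x")
  case 0
  then have "P.awalk x [] u"
    using assms layer_eq_0_iff root by (simp add: P.awalk_Nil_iff pverts_graph_power)
  then show ?thesis by (intro exI[of _ True] exI[of _ "[]"]) simp
next
  case (Suc i)
  show ?thesis
    using direct_walk[OF assms Suc, of "if i = 0 then side x else True"] by (cases "i = 0") auto
qed

text \<open>Here \<open>s\<close> is prescribed; a vertex unfit for a direct walk first takes an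
  edge of colour 0 to a fit vertex of its own layer.\<close>

lemma detour_walk:
  assumes nonstar: "\<exists>z\<in>pverts H. 2 \<le> lev z" and x: "x \<in> pverts H"
  shows "\<exists>p. P.awalk x p u \<and> distinct (colors p) \<and> set (colors p) \<subseteq> insert 0 (palette s (layer x))"
proof (cases "layer x")
  case 0
  then have "P.awalk x [] u"
    using x layer_eq_0_iff root by (simp add: P.awalk_Nil_iff pverts_graph_power)
  then show ?thesis by (intro exI[of _ "[]"]) simp
next
  case (Suc i)
  show ?thesis
  proof (cases "if i = 0 then side x = s else s \<or> \<not> k dvd lev x")
    case True
    then show ?thesis using direct_walk[OF x Suc] by blast
  next
    case False
    have "\<exists>y. (x, y) \<in> parcs (graph_power H k) \<and> layer y = Suc i \<and>
      (if i = 0 then side y = s else s \<or> \<not> k dvd lev y)"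
    proof (cases "i = 0")
      case True
      then show ?thesis using opposite_neighbour[OF nonstar x] Suc False by (metis One_nat_def)
    next
      case i: False
      have lx: "k * i < lev x" "lev x \<le> k * Suc i" using Suc layer_eq_Suc_iff by auto
      \<comment> \<open>Now \<open>s\<close> is false and \<open>k\<close> divides
        \<open>lev x\<close>, which leaves only the top level of the layer.\<close>
      moreover obtain m where m: "lev x = k * m" using False i by (auto elim: dvdE)
      ultimately have "i < m" "m \<le> Suc i" using k_ge_2 by (auto simp del: mult_Suc_right)
      then have top: "lev x = k * Suc i" using m by (simp add: le_Suc_eq)
      \<comment> \<open>By \<open>2 \<le> k\<close>, one level down is still in the layer and no
        multiple of \<open>k\<close>.\<close>
      have "lev x - 1 < lev x" using lx by simp
      from geodesic_step[OF root x this] obtain y z where yz: "(y, z) \<in> parcs H"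
        "lev y = lev x - 1" "gdist H y x = lev x - (lev x - 1)" by blast
      have y: "y \<in> pverts H" using yz(1) by (auto dest: in_arcsD1)
      have "gdist H x y \<le> k"
        using yz(3) lx k_ge_2 gdist_commute[OF pair_graph_axioms, of x y] by simp
      moreover have "x \<noteq> y" using yz(2) lx by auto
      ultimately have "(x, y) \<in> parcs (graph_power H k)" using power_arcI x y by simp
      moreover have "k * i < lev y" "lev y < k * Suc i" using yz(2) top k_ge_2 by auto
      moreover from this have "\<not> k dvd lev y"
        by (metis dvd_def mult_less_cancel1 less_Suc_eq_le not_le)
      ultimately show ?thesis using i layer_eq_Suc_iff[of y i] by (intro exI[of _ y]) auto
    qed
    then obtain y where y: "(x, y) \<in> parcs (graph_power H k)" "layer y = Suc i"
      "if i = 0 then side y = s else s \<or> \<not> k dvd lev y" by blast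
    have "y \<in> pverts H" using y(1) by (simp add: graph_power_def)
    from direct_walk[OF this y(2,3)] obtain p where
      p: "P.awalk y p u" "distinct (colors p)" "set (colors p) \<subseteq> palette s (Suc i)"
      using y(2) by auto
    have "0 \<notin> palette s (Suc i)" by (auto simp: palette_def)
    moreover have "coloring {x, y} = 0" using coloring_same y(2) Suc by simp
    ultimately show ?thesis using p y Suc
      by (intro exI[of _ "(x, y) # p"]) (auto simp: P.awalk_Cons_iff)
  qed
qed

lemma colors_rev_path: "colors (rev_path p) = rev (colors p)"
  by (induction p) (auto simp: insert_commute)

text \<open>The walk from \<open>x\<close> fixes \<open>s\<close>, and the walk from
  \<open>y\<close> uses the opposite palette. Only the latter may use colour 0, so joining them at
  the root repeats no colour.\<close>

lemma rainbow_coloring_coloring: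
  assumes "\<exists>z\<in>pverts H. 2 \<le> lev z"
  shows "rainbow_coloring (graph_power H k) coloring"
proof (rule rainbow_coloringI)
  fix x y assume "x \<in> pverts (graph_power H k)" "y \<in> pverts (graph_power H k)"
  then have xy: "x \<in> pverts H" "y \<in> pverts H" by (simp_all add: pverts_graph_power)
  obtain s p where p: "P.awalk x p u" "distinct (colors p)" "set (colors p) \<subseteq> palette s (layer x)"
    using some_direct_walk[OF xy(1)] by blast
  obtain q where q: "P.awalk y q u" "distinct (colors q)"
    "set (colors q) \<subseteq> insert 0 (palette (\<not> s) (layer y))"
    using detour_walk[OF assms xy(2)] by blast
  have "P.awalk x (p @ rev_path q) y"
    using P.awalk_appendI[OF p(1)] q(1) P.awalk_rev_path by blast
  moreover have "set (colors p) \<inter> set (colors q) = {}"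
    using p(3) q(3) palette_disjoint[of s "layer x" "layer y"] by blast
  then have "distinct (colors (p @ rev_path q))"
    using p(2) q(2) by (simp only: map_append colors_rev_path distinct_append distinct_rev set_rev simp_thms)
  ultimately show "\<exists>p. P.awalk x p y \<and> distinct (colors p)" by blast
qed (rule P.pair_graph_axioms)

end

theorem theorem1:
  fixes H :: "'a pair_pre_digraph" and k :: nat
  assumes "pair_graph H"
    and "Digraph_Component.connected (with_proj H)"
    and "2 \<le> card (pverts H)"
    and "2 \<le> k"
  shows "radius (graph_power H k) \<le> rc (graph_power H k)
    \<and> rc (graph_power H k) \<le> 2 * radius (graph_power H k) + 1"
proof
  let ?G = "graph_power H k"
  have G: "pair_graph ?G" using pair_graph_graph_power assms(1) .
  then interpret G: pair_graph ?G .
  have conn_power: "Digraph_Component.connected (with_proj ?G)"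
    using connected_graph_power[OF assms(1,2)] assms(4) by simp
  have pv: "pverts ?G = pverts H" by (rule pverts_graph_power)
  have nonempty: "pverts ?G \<noteq> {}" using assms(3) pv by auto
  show "radius ?G \<le> rc ?G" by (rule radius_le_rc[OF G conn_power nonempty])
  \<comment> \<open>The root is central in the power, so its eccentricity there bounds the
    layers.\<close>
  obtain u where u: "u \<in> pverts ?G" "ecc ?G u = radius ?G"
    using radius_attained[OF G.pair_finite_verts nonempty] by blast
  interpret H: pair_graph H by fact
  interpret rooted_graph_power H k u
    using assms u(1) pv by unfold_locales auto
  show "rc ?G \<le> 2 * radius ?G + 1"
  proof (cases "\<exists>z\<in>pverts H. 2 \<le> lev z")
    case True
    have lay: "layer x \<le> radius ?G" if x: "x \<in> pverts H" for x
    proof -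
      obtain p where p: "G.apath u p x" "length p = gdist ?G u x"
        using gdist_attained[OF G conn_power u(1)] x pv by auto
      have "lev x \<le> k * gdist ?G u x"
        using gdist_le_power_awalk[of k u p x] p by (simp add: G.apath_def)
      also have "\<dots> \<le> k * radius ?G"
        using gdist_le_ecc[OF G.pair_finite_verts, of x u] u(2) x pv by simp
      finally show ?thesis by (simp add: layer_le_iff)
    qed
    \<comment> \<open>Counting colour 0, these are \<open>2 * radius ?G + 1\<close> colours.\<close>
    have "coloring ` uedges ?G \<subseteq> {..2 * radius ?G}"
      using coloring_le lay by (auto simp: uedges_def graph_power_def)
    from rc_le[OF G rainbow_coloring_coloring[OF True] this] show ?thesis by simp
  next
    case False
    \<comment> \<open>Any two vertices are at distance at most 2 via the root, so a single colour
      will do.\<close>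
    have complete: "(x, y) \<in> parcs ?G" if "x \<in> pverts H" "y \<in> pverts H" "x \<noteq> y" for x y
    proof -
      have "lev x \<le> 1" "lev y \<le> 1" using False that by force+
      then have "gdist H x y \<le> 2"
        using gdist_triangle[OF that(1) root that(2)] gdist_commute[OF assms(1), of x u] by simp
      then show ?thesis using power_arcI that assms(4) by simp
    qed
    have "rainbow_coloring ?G (\<lambda>_. 0)"
    proof (rule rainbow_coloringI[OF G])
      fix x y assume xy: "x \<in> pverts ?G" "y \<in> pverts ?G"
      have "G.awalk x (if x = y then [] else [(x, y)]) y"
        using xy complete pv by (simp add: G.awalk_Nil_iff G.awalk_Cons_iff)
      then show "\<exists>p. G.awalk x p y \<and> distinct (map (\<lambda>(x, y). 0::nat) p)"
        by (intro exI[of _ "if x = y then [] else [(x, y)]"]) simp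
    qed
    moreover have "(\<lambda>_. 0::nat) ` uedges ?G \<subseteq> {0}" by blast
    ultimately show ?thesis using rc_le[OF G, of "\<lambda>_. 0" "{0}"] by simp
  qed
qed

end
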